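(* Let $f:\mathbb{R}^n\to\mathbb{R}^n$ be a monotone homogeneous map. If its recession function $\widehat f(x)=\lim_{\mu\to+\infty}\mu^{-1}f(\mu x)$ exists (for all $x\in\mathbb{R}^n$), is convex, and has only one critical class, then $f$ has an eigenvector, i.e. there are $v\in\mathbb{R}^n$ and $\lambda\in\mathbb{R}$ with $f(v)=\lambda+v$.
   Context: $\leq$ is the entrywise order of $\mathbb{R}^n$ and $\lambda+x=(\lambda+x_1,\dots,\lambda+x_n)$. A map $f$ is monotone if $x\le y\Rightarrow f(x)\le f(y)$, (additively) homogeneous if $f(\lambda+x)=\lambda+f(x)$ for all $\lambda\in\mathbb{R}$, and convex if each coordinate is convex. When the recession function $\widehat f$ exists it is monotone, homogeneous, and $\widehat f(0)=0$, so $0$ is an eigenvector of $\widehat f$. Critical classes of a convex monotone homogeneous map $g:\mathbb{R}^n\to\mathbb{R}^n$ with an eigenvector $v$ ($g(v)=\lambda+v$): $\partial g(v)=\{P\in\mathbb{R}^{n\times n}\mid g(x)-g(v)\ge P(x-v)\ \forall x\}$, whose elements are stochastic matrices. For a stochastic matrix $P$, $\mathscr{G}(P)$ is the directed graph on $\{1,\dots,n\}$ with arcs $i\to j$ when $P_{ij}\neq0$; its classes are the equivalence classes for mutual accessibility (each node has access to itself), a class is final if no node in it has access to a node outside it, and $\mathscr{G}^{f}(P)$ is the restriction of $\mathscr{G}(P)$ to the union of the final classes. The critical graph is $\mathscr{G}^{c}(g)=\bigcup_{P\in\partial g(v)}\mathscr{G}^{f}(P)$ (it does not depend on the choice of the eigenvector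 $v$), and the critical classes of $g$ are the node sets of the strongly connected components of $\mathscr{G}^{c}(g)$. *)

theory Defs
  imports "Graph_Theory.Digraph_Component" "HOL-Analysis.Analysis"
begin

hide_const (open) Digraph_Component.connected

definition add_const :: "real \<Rightarrow> real ^ 'n \<Rightarrow> real ^ 'n" where
  "add_const c x = (\<chi> i. c + x $ i)"

definition add_homogeneous :: "(real ^ 'n \<Rightarrow> real ^ 'n) \<Rightarrow> bool" where
  "add_homogeneous f \<longleftrightarrow> (\<forall>c x. f (add_const c x) = add_const c (f x))"

definition convex_map :: "(real ^ 'n \<Rightarrow> real ^ 'n) \<Rightarrow> bool" where
  "convex_map f \<longleftrightarrow> (\<forall>i. convex_on UNIV (\<lambda>x. f x $ i))"

definition eigenvector :: "(real ^ 'n \<Rightarrow> real ^ 'n) \<Rightarrow> real ^ 'n \<Rightarrow> bool" where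
  "eigenvector f v \<longleftrightarrow> (\<exists>c. f v = add_const c v)"

definition has_recession_function ::
    "(real ^ 'n \<Rightarrow> real ^ 'n) \<Rightarrow> (real ^ 'n \<Rightarrow> real ^ 'n) \<Rightarrow> bool" where
  "has_recession_function f fhat \<longleftrightarrow>
     (\<forall>x. ((\<lambda>\<mu>::real. inverse \<mu> *\<^sub>R f (\<mu> *\<^sub>R x)) \<longlongrightarrow> fhat x) at_top)"

definition subdifferential ::
    "(real ^ 'n \<Rightarrow> real ^ 'n) \<Rightarrow> real ^ 'n \<Rightarrow> (real ^ 'n ^ 'n) set" where
  "subdifferential g v = {P. \<forall>x. g x - g v \<ge> P *v (x - v)}"

definition matrix_graph :: "real ^ 'n ^ 'n \<Rightarrow> ('n, 'n \<times> 'n) pre_digraph" where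
  "matrix_graph P =
     \<lparr>verts = UNIV, arcs = {(i, j). P $ i $ j \<noteq> 0}, tail = fst, head = snd\<rparr>"

definition final_classes :: "('a, 'b) pre_digraph \<Rightarrow> 'a set set" where
  "final_classes G = {C \<in> pre_digraph.sccs_verts G.
     \<forall>u\<in>C. \<forall>w. w \<notin> C \<longrightarrow> \<not> reachable G u w}"

definition final_graph :: "real ^ 'n ^ 'n \<Rightarrow> ('n, 'n \<times> 'n) pre_digraph" where
  "final_graph P = induce_subgraph (matrix_graph P) (\<Union> (final_classes (matrix_graph P)))"

text \<open>The critical graph and the critical classes of a convex monotone homogeneous map \<open>g\<close>
  are computed at an eigenvector \<open>v\<close> of \<open>g\<close>, which is kept as an argument; for such \<open>g\<close> they
  are the same for every eigenvector. The node set of the critical graph is in general a proper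
  subset of the index type: it consists of the nodes of the graphs in the union only.\<close>

definition critical_graph ::
    "(real ^ 'n \<Rightarrow> real ^ 'n) \<Rightarrow> real ^ 'n \<Rightarrow> ('n, 'n \<times> 'n) pre_digraph" where
  "critical_graph g v =
     \<lparr>verts = (\<Union>P\<in>subdifferential g v. verts (final_graph P)),
      arcs = (\<Union>P\<in>subdifferential g v. arcs (final_graph P)),
      tail = fst, head = snd\<rparr>"

definition critical_classes :: "(real ^ 'n \<Rightarrow> real ^ 'n) \<Rightarrow> real ^ 'n \<Rightarrow> 'n set set" where
  "critical_classes g v = pre_digraph.sccs_verts (critical_graph g v)"

end

theory Submission
  imports Defs "HOL-Real_Asymp.Real_Asymp"
begin

text \<open>Fixed points \<open>x\<^sub>\<alpha> = f (\<alpha> x\<^sub>\<alpha>)\<close> exist for every \<open>\<alpha> < 1\<close> by Brouwer's theorem. Normalised to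
  minimum \<open>0\<close>, the vectors \<open>\<alpha> x\<^sub>\<alpha>\<close> either accumulate at an eigenvector of \<open>f\<close> as \<open>\<alpha> \<rightarrow> 1\<close>, or,
  rescaled to norm \<open>1\<close>, at a non-constant eigenvector of the recession function \<open>g\<close>. The
  latter is impossible: let \<open>y = x - w\<close> be the difference of two eigenvectors of \<open>g\<close>. Subgradients
  at \<open>w\<close> make \<open>y\<close> superharmonic, so it is constant on the critical class and takes its minimum
  there. A subgradient \<open>Q\<close> at \<open>x\<close> makes \<open>y\<close> subharmonic, so \<open>y\<close> takes its maximum on a final class
  of \<open>Q\<close>, which turns out to be critical as well.\<close>

lemma less_eq_vec_iff: "x \<le> y \<longleftrightarrow> (\<forall>i. x $ i \<le> y $ i)" for x y :: "real ^ 'n"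
  by (simp add: less_eq_vec_def)

lemma add_const_nth [simp]: "add_const c x $ i = c + x $ i"
  by (simp add: add_const_def)

lemma add_homogeneousD: "add_homogeneous f \<Longrightarrow> f (add_const c x) = add_const c (f x)"
  by (simp add: add_homogeneous_def)


section \<open>Monotone homogeneous maps\<close>

text \<open>Each of \<open>x\<close>, \<open>y\<close> lies below the other one shifted by
  \<open>norm (x - y)\<close>, and a monotone homogeneous map carries the shift through. This gives
  continuity, and a Lipschitz bound that survives rescaling.\<close>

lemma nonexpansive_component:
  fixes f :: "real ^ 'n \<Rightarrow> real ^ 'n"
  assumes "mono f" "add_homogeneous f"
  shows "\<bar>f x $ i - f y $ i\<bar> \<le> norm (x - y)"
proof -
  have *: "f a $ i - f b $ i \<le> norm (a - b)" for a b
  proof -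
    have "a $ j \<le> norm (a - b) + b $ j" for j
      using component_le_norm_cart[of "a - b" j] by simp
    then have "a \<le> add_const (norm (a - b)) b"
      by (simp add: less_eq_vec_iff)
    then have "f a \<le> add_const (norm (a - b)) (f b)"
      using monoD[OF assms(1)] add_homogeneousD[OF assms(2)] by metis
    then have "f a $ i \<le> norm (a - b) + f b $ i"
      by (simp add: less_eq_vec_iff)
    then show ?thesis by simp
  qed
  show ?thesis using *[of x y] *[of y x] by (simp add: norm_minus_commute abs_le_iff)
qed

lemma tendsto_nonexpansive:
  fixes f :: "real ^ 'n \<Rightarrow> real ^ 'n"
  assumes "mono f" "add_homogeneous f" and "(u \<longlongrightarrow> l) F"
  shows "((\<lambda>n. f (u n)) \<longlongrightarrow> f l) F"
proof (rule vec_tendstoI)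
  fix i
  have "((\<lambda>n. norm (u n - l)) \<longlongrightarrow> 0) F"
    using assms(3) by (simp add: LIM_zero tendsto_norm_zero)
  then have "((\<lambda>n. f (u n) $ i - f l $ i) \<longlongrightarrow> 0) F"
    by (rule Lim_null_comparison[rotated])
      (simp add: nonexpansive_component[OF assms(1,2)])
  then show "((\<lambda>n. f (u n) $ i) \<longlongrightarrow> f l $ i) F"
    by (rule LIM_zero_cancel)
qed

text \<open>\<open>g\<close> fixes all constant vectors, so the constant bounds \<open>m\<close> and
  \<open>M\<close> of \<open>x\<close> also bound \<open>g x\<close>. Where \<open>x\<close> attains
  \<open>M\<close> this forces c \<le> 0, and where it attains \<open>m\<close> it forces 0 \<le>
  c.\<close>

lemma eigenvalue_zero:
  fixes g :: "real ^ 'n \<Rightarrow> real ^ 'n"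
  assumes "mono g" "add_homogeneous g" "g 0 = 0" and "g x = add_const c x"
  shows "c = 0"
proof -
  have const: "g (add_const m 0) = add_const m 0" for m
    using add_homogeneousD[OF assms(2)] assms(3) by metis
  define M where "M = Max (range (($) x))"
  define m where "m = Min (range (($) x))"
  have M: "x $ i \<le> M" and m: "m \<le> x $ i" for i
    by (auto simp: M_def m_def)
  have "M \<in> range (($) x)" "m \<in> range (($) x)"
    unfolding M_def m_def by (rule Max_in Min_in; simp)+
  then obtain i j where ij: "x $ i = M" "x $ j = m" by auto
  have "x \<le> add_const M 0" "add_const m 0 \<le> x"
    using M m by (simp_all add: less_eq_vec_iff)
  then have "g x \<le> add_const M 0" "add_const m 0 \<le> g x"
    using monoD[OF assms(1)] const by metis+
  then have "c + x $ i \<le> M" "m \<le> c + x $ j"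
    by (auto simp: less_eq_vec_iff assms(4))
  then show ?thesis using ij by simp
qed

section \<open>Properties inherited by the recession function\<close>

lemma recession_component:
  assumes "has_recession_function f fhat"
  shows "((\<lambda>\<mu>. inverse \<mu> * f (\<mu> *\<^sub>R x) $ i) \<longlongrightarrow> fhat x $ i) at_top"
proof -
  have "((\<lambda>\<mu>. (inverse \<mu> *\<^sub>R f (\<mu> *\<^sub>R x)) $ i) \<longlongrightarrow> fhat x $ i) at_top"
    using assms by (intro tendsto_vec_nth) (auto simp: has_recession_function_def)
  then show ?thesis by simp
qed

lemma mono_recession:
  fixes f fhat :: "real ^ 'n \<Rightarrow> real ^ 'n"
  assumes "mono f" "has_recession_function f fhat"
  shows "mono fhat"
proof (rule monoI)
  fix x y :: "real ^ 'n" assume "x \<le> y"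
  show "fhat x \<le> fhat y"
    unfolding less_eq_vec_iff
  proof
    fix i
    have "eventually (\<lambda>\<mu>. inverse \<mu> * f (\<mu> *\<^sub>R x) $ i \<le> inverse \<mu> * f (\<mu> *\<^sub>R y) $ i) at_top"
      using eventually_gt_at_top[of 0]
    proof eventually_elim
      case (elim \<mu>)
      then have "\<mu> *\<^sub>R x \<le> \<mu> *\<^sub>R y"
        using \<open>x \<le> y\<close> by (simp add: less_eq_vec_iff)
      then have "f (\<mu> *\<^sub>R x) \<le> f (\<mu> *\<^sub>R y)" by (rule monoD[OF assms(1)])
      then show ?case using elim by (simp add: less_eq_vec_iff)
    qed
    then show "fhat x $ i \<le> fhat y $ i"
      by (rule tendsto_le[OF trivial_limit_at_top_linorder
            recession_component[OF assms(2)] recession_component[OF assms(2)]])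
  qed
qed

lemma add_homogeneous_recession:
  fixes f fhat :: "real ^ 'n \<Rightarrow> real ^ 'n"
  assumes "add_homogeneous f" "has_recession_function f fhat"
  shows "add_homogeneous fhat"
  unfolding add_homogeneous_def
proof (intro allI vec_eq_iff[THEN iffD2])
  fix c i and x :: "real ^ 'n"
  have "eventually (\<lambda>\<mu>. c + inverse \<mu> * f (\<mu> *\<^sub>R x) $ i
      = inverse \<mu> * f (\<mu> *\<^sub>R add_const c x) $ i) at_top"
    using eventually_gt_at_top[of 0]
  proof eventually_elim
    case (elim \<mu>)
    have "\<mu> *\<^sub>R add_const c x = add_const (\<mu> * c) (\<mu> *\<^sub>R x)"
      by (simp add: vec_eq_iff algebra_simps)
    then show ?case
      using elim by (simp add: add_homogeneousD[OF assms(1)] field_simps)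
  qed
  then have "((\<lambda>\<mu>. inverse \<mu> * f (\<mu> *\<^sub>R add_const c x) $ i) \<longlongrightarrow> c + fhat x $ i) at_top"
    by (rule Lim_transform_eventually[rotated])
      (intro tendsto_intros recession_component assms)
  then show "fhat (add_const c x) $ i = add_const c (fhat x) $ i"
    using tendsto_unique[OF trivial_limit_at_top_linorder recession_component[OF assms(2)]]
    by fastforce
qed

lemma recession_zero:
  fixes f fhat :: "real ^ 'n \<Rightarrow> real ^ 'n"
  assumes "has_recession_function f fhat"
  shows "fhat 0 = 0"
proof -
  have "((\<lambda>\<mu>::real. inverse \<mu> *\<^sub>R f 0) \<longlongrightarrow> 0 *\<^sub>R f 0) at_top"
    by (intro tendsto_intros tendsto_inverse_0_at_top filterlim_ident)
  moreover have "((\<lambda>\<mu>::real. inverse \<mu> *\<^sub>R f 0) \<longlongrightarrow> fhat 0) at_top"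
    using assms[unfolded has_recession_function_def, rule_format, of 0] by simp
  ultimately show ?thesis
    using tendsto_unique[OF trivial_limit_at_top_linorder] by fastforce
qed


section \<open>Subdifferentials\<close>

lemma convex_on_subgradient:
  fixes h :: "'a :: euclidean_space \<Rightarrow> real"
  assumes "convex_on UNIV h"
  shows "\<exists>a. \<forall>x. h x - h v \<ge> a \<bullet> (x - v)"
proof -
  \<comment> \<open>The strict epigraph of \<open>h\<close>, translated so that the point of the
    graph over \<open>v\<close> becomes the origin; strictness keeps \<open>0\<close>
    outside.\<close>
  define S where "S = {p. h (fst p + v) - h v < snd p}"
  have "convex S"
  proof (rule convexI)
    fix p q :: "'a \<times> real" and s t :: real
    assume pq: "p \<in> S" "q \<in> S" and st: "0 \<le> s" "0 \<le> t" "s + t = 1"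
    have "s *\<^sub>R fst p + t *\<^sub>R fst q + v = s *\<^sub>R (fst p + v) + t *\<^sub>R (fst q + v)"
      using st by (simp add: algebra_simps flip: scaleR_add_left)
    then have "h (s *\<^sub>R fst p + t *\<^sub>R fst q + v) \<le> s * h (fst p + v) + t * h (fst q + v)"
      using assms st by (simp add: convex_on_def)
    moreover have "s * (h (fst p + v) - h v - snd p) + t * (h (fst q + v) - h v - snd q) < 0"
      using pq st by (intro convex_bound_lt) (auto simp: S_def)
    moreover have "s * h v + t * h v = h v"
      using st by (simp flip: distrib_right)
    ultimately show "s *\<^sub>R p + t *\<^sub>R q \<in> S"
      by (simp add: S_def algebra_simps)
  qed
  moreover have "0 \<notin> S" by (simp add: S_def)
  ultimately obtain c where c: "c \<noteq> 0" "\<forall>p\<in>S. 0 \<le> c \<bullet> p"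
    using separating_hyperplane_set_0 by blast
  obtain b \<beta> where [simp]: "c = (b, \<beta>)" by (cases c)
  have sep: "0 \<le> b \<bullet> x + \<beta> * t" if "h (x + v) - h v < t" for x t
    using c(2)[rule_format, of "(x, t)"] that by (simp add: S_def)
  \<comment> \<open>The separating hyperplane cannot be vertical, because the epigraph lies over
    every point of the space, in particular over the direction - b.\<close>
  have "\<beta> \<noteq> 0"
  proof
    assume "\<beta> = 0"
    have "0 \<le> b \<bullet> (- b)"
      using sep[of "- b" "h (- b + v) - h v + 1"] \<open>\<beta> = 0\<close> by simp
    then have "b = 0" by (metis inner_eq_zero_iff inner_ge_zero inner_minus_right
          neg_0_le_iff_le order_antisym)
    then show False using c(1) \<open>\<beta> = 0\<close> by (simp add: zero_prod_def)
  qed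
  moreover have "0 \<le> \<beta>" using sep[of 0 1] by simp
  ultimately have "\<beta> > 0" by simp
  have "h x - h v \<ge> (- b /\<^sub>R \<beta>) \<bullet> (x - v)" for x
  \<comment> \<open>Points of the graph are not in \<open>S\<close>, so they are approached from
    above.\<close>
  proof (rule field_le_epsilon)
    fix e :: real assume "e > 0"
    then have "0 \<le> b \<bullet> (x - v) + \<beta> * (h x - h v + e)"
      by (intro sep) simp
    then show "(- b /\<^sub>R \<beta>) \<bullet> (x - v) \<le> h x - h v + e"
      using \<open>\<beta> > 0\<close> by (simp add: field_simps)
  qed
  then show ?thesis by blast
qed

lemma mem_subdifferential_iff:
  "P \<in> subdifferential g v \<longleftrightarrow>
    (\<forall>x i. (\<Sum>j\<in>UNIV. P $ i $ j * (x $ j - v $ j)) \<le> g x $ i - g v $ i)"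
  by (simp add: subdifferential_def less_eq_vec_iff matrix_vector_mult_def)

lemma subdifferential_nonempty:
  fixes g :: "real ^ 'n \<Rightarrow> real ^ 'n"
  assumes "convex_map g"
  shows "\<exists>P. P \<in> subdifferential g v"
proof -
  have "\<forall>i. \<exists>a. \<forall>x. g x $ i - g v $ i \<ge> a \<bullet> (x - v)"
    using assms by (auto simp: convex_map_def intro: convex_on_subgradient)
  then obtain a where "\<forall>i x. g x $ i - g v $ i \<ge> a i \<bullet> (x - v)"
    by metis
  then have "(\<chi> i. a i) \<in> subdifferential g v"
    by (simp add: mem_subdifferential_iff inner_vec_def)
  then show ?thesis by blast
qed

definition stochastic :: "real ^ 'n ^ 'n \<Rightarrow> bool" where
  "stochastic P \<longleftrightarrow> (\<forall>i j. 0 \<le> P $ i $ j) \<and> (\<forall>i. (\<Sum>j\<in>UNIV. P $ i $ j) = 1)"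

text \<open>Test the subgradient inequality at shifts of \<open>v\<close>: the constants 1 and -1
  give the row sums, and lowering coordinate \<open>j\<close> alone gives the sign of the entries in
  column \<open>j\<close>.\<close>

lemma subdifferential_stochastic:
  fixes g :: "real ^ 'n \<Rightarrow> real ^ 'n"
  assumes "mono g" "add_homogeneous g" and P: "P \<in> subdifferential g v"
  shows "stochastic P"
  unfolding stochastic_def
proof (intro conjI allI)
  note P = P[unfolded mem_subdifferential_iff, rule_format]
  fix i
  have "(\<Sum>j\<in>UNIV. P $ i $ j * c) \<le> c" for c
    using P[of i "add_const c v"] by (simp add: add_homogeneousD[OF assms(2)])
  from this[of 1] this[of "-1"] show "(\<Sum>j\<in>UNIV. P $ i $ j) = 1"
    by (simp add: sum_negf)
  fix j
  have "v - axis j 1 \<le> v" by (simp add: less_eq_vec_iff axis_def)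
  then have "g (v - axis j 1) $ i \<le> g v $ i"
    using monoD[OF assms(1)] by (simp add: less_eq_vec_iff)
  moreover have "(\<Sum>k\<in>UNIV. P $ i $ k * ((v - axis j 1) $ k - v $ k)) = (\<Sum>k\<in>UNIV. if k = j then - (P $ i $ k) else 0)"
    by (intro sum.cong) (auto simp: axis_def)
  ultimately show "0 \<le> P $ i $ j"
    using P[of i "v - axis j 1"] by simp
qed


section \<open>Final classes of stochastic matrices\<close>

definition support :: "real ^ 'n ^ 'n \<Rightarrow> ('n \<times> 'n) set" where
  "support P = {(i, j). P $ i $ j \<noteq> 0}"

lemma reachable_matrix_graph: "reachable (matrix_graph P) i j \<longleftrightarrow> (i, j) \<in> (support P)\<^sup>*"
proof -
  interpret wf_digraph "matrix_graph P"
    by unfold_locales (auto simp: matrix_graph_def)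
  have "arcs_ends (matrix_graph P) = support P" "verts (matrix_graph P) = UNIV"
    by (auto simp: arcs_ends_def arc_to_ends_def matrix_graph_def support_def)
  then show ?thesis
    using reachable_conv[of i j] by simp
qed

text \<open>Strong connectedness, maximality and finality merge into one condition: from each node
  of \<open>F\<close> exactly the nodes of \<open>F\<close> are accessible.\<close>

lemma final_classes_iff:
  "F \<in> final_classes (matrix_graph P) \<longleftrightarrow> F \<noteq> {} \<and> (\<forall>i\<in>F. (support P)\<^sup>* `` {i} = F)"
proof
  assume "F \<in> final_classes (matrix_graph P)"
  then show "F \<noteq> {} \<and> (\<forall>i\<in>F. (support P)\<^sup>* `` {i} = F)"
    unfolding final_classes_def pre_digraph.sccs_verts_def reachable_matrix_graph by blast
next
  assume F: "F \<noteq> {} \<and> (\<forall>i\<in>F. (support P)\<^sup>* `` {i} = F)"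
  then have "(i, j) \<in> (support P)\<^sup>* \<longleftrightarrow> j \<in> F" if "i \<in> F" for i j
    using that by blast
  with F show "F \<in> final_classes (matrix_graph P)"
    by (simp add: final_classes_def pre_digraph.sccs_verts_def reachable_matrix_graph)
qed

lemma final_class_closed:
  assumes "F \<in> final_classes (matrix_graph P)" "i \<in> F" "P $ i $ j \<noteq> 0"
  shows "j \<in> F"
proof -
  have "(i, j) \<in> (support P)\<^sup>*" using assms(3) by (auto simp: support_def)
  then show ?thesis using assms(1,2) unfolding final_classes_iff by blast
qed

text \<open>Take a node of \<open>S\<close> whose set of accessible nodes is smallest. Every node in
  that set has access to a subset of it, hence by minimality to all of it.\<close>

lemma exists_final_class:
  fixes P :: "real ^ 'n ^ 'n"
  assumes "S \<noteq> {}" and closed: "\<And>i j. i \<in> S \<Longrightarrow> P $ i $ j \<noteq> 0 \<Longrightarrow> j \<in> S"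
  obtains F where "F \<in> final_classes (matrix_graph P)" "F \<subseteq> S"
proof -
  define R where "R i = (support P)\<^sup>* `` {i}" for i
  obtain i where i: "i \<in> S" and least: "\<And>j. j \<in> S \<Longrightarrow> card (R i) \<le> card (R j)"
    using assms(1) ex_has_least_nat[of "\<lambda>i. i \<in> S" _ "\<lambda>i. card (R i)"] by blast
  have S: "k \<in> S" if "(i, k) \<in> (support P)\<^sup>*" for k
    using that by induction (use i closed in \<open>auto simp: support_def\<close>)
  have "R j = R i" if "j \<in> R i" for j
  proof (rule card_seteq)
    show "R j \<subseteq> R i" using that by (auto simp: R_def)
    show "card (R i) \<le> card (R j)" using that by (intro least S) (simp add: R_def)
  qed simp
  moreover have "i \<in> R i" by (simp add: R_def)
  ultimately have "R i \<in> final_classes (matrix_graph P)"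
    unfolding final_classes_iff R_def[symmetric] by blast
  moreover have "R i \<subseteq> S" using S by (auto simp: R_def)
  ultimately show thesis by (rule that)
qed

text \<open>Paths starting in \<open>F\<close> never leave \<open>F\<close>, so they only see the
  rows indexed by \<open>F\<close>.\<close>

lemma final_class_cong:
  fixes P Q :: "real ^ 'n ^ 'n"
  assumes F: "F \<in> final_classes (matrix_graph Q)" and eq: "\<And>i. i \<in> F \<Longrightarrow> P $ i = Q $ i"
  shows "F \<in> final_classes (matrix_graph P)"
proof -
  have "(support P)\<^sup>* `` {i} = (support Q)\<^sup>* `` {i}" if "i \<in> F" for i
  proof -
    have "(i, k) \<in> (support P)\<^sup>* \<Longrightarrow> k \<in> F \<and> (i, k) \<in> (support Q)\<^sup>*" for k
    proof (induction rule: rtrancl_induct)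
      case (step j k)
      then have "(j, k) \<in> support Q" by (simp add: support_def eq)
      then show ?case using step.IH final_class_closed[OF F, of j k]
        by (auto simp: support_def intro: rtrancl_into_rtrancl)
    qed (use that in auto)
    moreover have "(i, k) \<in> (support Q)\<^sup>* \<Longrightarrow> k \<in> F \<and> (i, k) \<in> (support P)\<^sup>*" for k
    proof (induction rule: rtrancl_induct)
      case (step j k)
      then have "(j, k) \<in> support P" by (simp add: support_def eq)
      then show ?case using step final_class_closed[OF F, of j k]
        by (auto simp: support_def intro: rtrancl_into_rtrancl)
    qed (use that in auto)
    ultimately show ?thesis by auto
  qed
  then show ?thesis using F by (simp add: final_classes_iff)
qed

text \<open>A weighted average of values \<le> m can reach \<open>m\<close> only if every value of
  nonzero weight equals \<open>m\<close>: the nonnegative terms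
  \<open>P $ i $ k * (m - y $ k)\<close> sum to zero.\<close>

lemma stochastic_maximum_principle:
  fixes P :: "real ^ 'n ^ 'n"
  assumes "stochastic P" and "P $ i $ j \<noteq> 0"
    and le: "\<And>k. P $ i $ k \<noteq> 0 \<Longrightarrow> y $ k \<le> m"
    and sub: "m \<le> (\<Sum>k\<in>UNIV. P $ i $ k * y $ k)"
  shows "y $ j = m"
proof -
  have P: "0 \<le> P $ i $ k" "(\<Sum>k\<in>UNIV. P $ i $ k) = 1" for k
    using assms(1) by (auto simp: stochastic_def)
  have nonneg: "0 \<le> P $ i $ k * (m - y $ k)" for k
    using P(1) le[of k] by (cases "P $ i $ k = 0") auto
  have "(\<Sum>k\<in>UNIV. P $ i $ k * (m - y $ k)) = m - (\<Sum>k\<in>UNIV. P $ i $ k * y $ k)"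
    using P(2) by (simp add: right_diff_distrib sum_subtractf flip: sum_distrib_right)
  then have "(\<Sum>k\<in>UNIV. P $ i $ k * (m - y $ k)) = 0"
    using sub sum_nonneg[of UNIV "\<lambda>k. P $ i $ k * (m - y $ k)"] nonneg by simp
  then have "P $ i $ j * (m - y $ j) = 0"
    using nonneg sum_nonneg_eq_0_iff[of UNIV "\<lambda>k. P $ i $ k * (m - y $ k)"] by simp
  then show ?thesis using assms(2) by simp
qed

text \<open>By the maximum principle the set of maximisers of \<open>y\<close> is closed under the
  arcs of \<open>P\<close>, so it contains a final class.\<close>

lemma maximum_on_final_class:
  fixes P :: "real ^ 'n ^ 'n"
  assumes "stochastic P" and sub: "\<And>i. y $ i \<le> (\<Sum>k\<in>UNIV. P $ i $ k * y $ k)"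
  obtains F where "F \<in> final_classes (matrix_graph P)" "\<And>i k. i \<in> F \<Longrightarrow> y $ k \<le> y $ i"
proof -
  define m where "m = Max (range (($) y))"
  have m: "y $ k \<le> m" for k by (simp add: m_def)
  have "m \<in> range (($) y)"
    unfolding m_def by (rule Max_in) simp_all
  then have "{i. y $ i = m} \<noteq> {}" by auto
  moreover have "j \<in> {i. y $ i = m}" if "i \<in> {i. y $ i = m}" "P $ i $ j \<noteq> 0" for i j
    using stochastic_maximum_principle[OF assms(1) that(2), of y m] m sub[of i] that(1) by simp
  ultimately obtain F where "F \<in> final_classes (matrix_graph P)" "F \<subseteq> {i. y $ i = m}"
    by (rule exists_final_class) blast+
  then show thesis using m by (intro that) auto
qed

text \<open>The maximum over \<open>F\<close> propagates along paths, and within \<open>F\<close>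
  every node is accessible from a maximiser. A bound on \<open>F\<close> alone suffices because arcs
  do not leave \<open>F\<close>.\<close>

lemma subharmonic_constant_on_final_class:
  fixes P :: "real ^ 'n ^ 'n"
  assumes "stochastic P" and sub: "\<And>i. y $ i \<le> (\<Sum>k\<in>UNIV. P $ i $ k * y $ k)"
    and F: "F \<in> final_classes (matrix_graph P)" and "i \<in> F" "j \<in> F"
  shows "y $ i = y $ j"
proof -
  define m where "m = Max ((($) y) ` F)"
  have m: "y $ k \<le> m" if "k \<in> F" for k using that by (simp add: m_def)
  have "m \<in> (($) y) ` F"
    unfolding m_def using \<open>i \<in> F\<close> by (intro Max_in) auto
  then obtain i0 where i0: "i0 \<in> F" "y $ i0 = m" by auto
  have "y $ k = m" if "k \<in> F" for k
  proof -
    have "(i0, k) \<in> (support P)\<^sup>*"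
      using F i0(1) that by (auto simp: final_classes_iff)
    then have "k \<in> F \<and> y $ k = m"
    proof (induction rule: rtrancl_induct)
      case (step a b)
      then have ab: "P $ a $ b \<noteq> 0" "a \<in> F" "y $ a = m" by (auto simp: support_def)
      then have "y $ b = m"
        using stochastic_maximum_principle[OF assms(1) ab(1), of y m] m sub[of a]
          final_class_closed[OF F] by simp
      then show ?case using final_class_closed[OF F ab(2,1)] by simp
    qed (use i0 in auto)
    then show ?thesis by simp
  qed
  then show ?thesis using assms(4,5) by simp
qed


section \<open>Uniqueness of eigenvectors\<close>

lemma unique_scc_reachable:
  assumes "wf_digraph G" "\<exists>!C. C \<in> pre_digraph.sccs_verts G" "i \<in> verts G" "j \<in> verts G"
  shows "reachable G i j"
proof -
  interpret wf_digraph G by fact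
  have "scc_of i = scc_of j"
    using assms(2-4) scc_of_in_sccs_verts by blast
  then have "j \<in> scc_of i" using in_scc_of_self[OF assms(4)] by simp
  then show ?thesis by (simp add: scc_of_def)
qed

lemma wf_critical_graph: "wf_digraph (critical_graph g v)"
  by unfold_locales (auto simp: critical_graph_def final_graph_def matrix_graph_def)

lemma verts_critical_graph:
  "i \<in> verts (critical_graph g v) \<longleftrightarrow>
    (\<exists>P\<in>subdifferential g v. \<exists>F\<in>final_classes (matrix_graph P). i \<in> F)"
  by (simp add: critical_graph_def final_graph_def)

lemma adj_critical_graphE:
  assumes "(i, j) \<in> arcs_ends (critical_graph g v)"
  obtains P F where "P \<in> subdifferential g v" "F \<in> final_classes (matrix_graph P)"
    "i \<in> F" "P $ i $ j \<noteq> 0"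
  using assms
  by (auto simp: critical_graph_def final_graph_def matrix_graph_def arcs_ends_def arc_to_ends_def)

lemma eigenvectors_differ_by_constant:
  fixes g :: "real ^ 'n \<Rightarrow> real ^ 'n"
  assumes "mono g" "add_homogeneous g" "convex_map g"
    and w: "g w = w" and x: "g x = x"
    and unique: "\<exists>!C. C \<in> critical_classes g w"
  shows "\<exists>c. x = add_const c w"
proof -
  define y where "y = x - w"
  let ?G = "critical_graph g w"
  have sto: "P \<in> subdifferential g v \<Longrightarrow> stochastic P" for P v
    by (rule subdifferential_stochastic[OF assms(1,2)])
  \<comment> \<open>Testing the subgradient at \<open>x\<close> gives P y \<le> y, since
    \<open>g\<close> fixes both points. The sign is flipped so that the results on subharmonic
    vectors apply.\<close>
  have super: "(- y) $ i \<le> (\<Sum>k\<in>UNIV. P $ i $ k * (- y) $ k)"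
    if "P \<in> subdifferential g w" for P i
    using that[unfolded mem_subdifferential_iff, rule_format, of i x]
    by (simp add: y_def x w right_diff_distrib sum_subtractf)

  have adj: "y $ i = y $ j" if "(i, j) \<in> arcs_ends ?G" for i j
    using that
  proof (rule adj_critical_graphE)
    fix P F
    assume P: "P \<in> subdifferential g w" and F: "F \<in> final_classes (matrix_graph P)"
      "i \<in> F" "P $ i $ j \<noteq> 0"
    have "(- y) $ i = (- y) $ j"
      by (rule subharmonic_constant_on_final_class[OF sto[OF P] super[OF P] F(1,2)])
        (rule final_class_closed[OF F])
    then show ?thesis by simp
  qed
  have const: "y $ i = y $ j" if "i \<in> verts ?G" "j \<in> verts ?G" for i j
  proof -
    have "reachable ?G i j"
      using that unique unfolding critical_classes_def
      by (intro unique_scc_reachable wf_critical_graph)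
    then have "(i, j) \<in> (arcs_ends ?G)\<^sup>*"
      by (rule reachable_rtranclI)
    then show ?thesis
      by (induction rule: rtrancl_induct) (use adj in auto)
  qed

  \<comment> \<open>The minimum of \<open>y\<close> is attained at a critical node
    \<open>i\<close>.\<close>
  obtain P where P: "P \<in> subdifferential g w"
    using subdifferential_nonempty[OF assms(3)] by blast
  obtain E where E: "E \<in> final_classes (matrix_graph P)"
    "\<And>i k. i \<in> E \<Longrightarrow> (- y) $ k \<le> (- y) $ i"
    by (rule maximum_on_final_class[OF sto[OF P] super[OF P]]) blast
  obtain i where "i \<in> E" using E(1) by (auto simp: final_classes_iff)
  have i: "i \<in> verts ?G" "y $ i \<le> y $ k" for k
    using P E \<open>i \<in> E\<close> by (auto simp: verts_critical_graph)

  obtain Q where Q: "Q \<in> subdifferential g x"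
    using subdifferential_nonempty[OF assms(3)] by blast
  \<comment> \<open>Now the base point is \<open>x\<close> and the test point \<open>w\<close>,
    which reverses the inequality to y \<le> Q y.\<close>
  have sub: "y $ j \<le> (\<Sum>k\<in>UNIV. Q $ j $ k * y $ k)" for j
    using Q[unfolded mem_subdifferential_iff, rule_format, of j w]
    by (simp add: y_def x w right_diff_distrib sum_subtractf)
  obtain F where F: "F \<in> final_classes (matrix_graph Q)" "\<And>j k. j \<in> F \<Longrightarrow> y $ k \<le> y $ j"
    by (rule maximum_on_final_class[OF sto[OF Q] sub]) blast
  obtain j where "j \<in> F" using F(1) by (auto simp: final_classes_iff)

  text \<open>On \<open>F\<close> the vector \<open>y\<close> is \<open>Q\<close>-harmonic, so the rows of \<open>Q\<close> indexed by \<open>F\<close>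
    are subgradients at \<open>w\<close> too, and \<open>F\<close> consists of critical nodes at \<open>w\<close>.\<close>
  define R where "R = (\<chi> i. if i \<in> F then Q $ i else P $ i)"
  \<comment> \<open>The subgradient inequality is a condition on each row separately, so rows of
    \<open>Q\<close> and \<open>P\<close> may be mixed.\<close>
  have "(\<Sum>k\<in>UNIV. R $ i $ k * (z $ k - w $ k)) \<le> g z $ i - g w $ i" for z i
  proof (cases "i \<in> F")
    case True
    \<comment> \<open>Since \<open>y\<close> is maximal at \<open>i\<close>, row \<open>i\<close> of
      Q y is at most \<open>x $ i - w $ i\<close>. Adding the subgradient inequality at
      \<open>x\<close> moves the base point from \<open>x\<close> to \<open>w\<close>.\<close>
    have "(\<Sum>k\<in>UNIV. Q $ i $ k * y $ k) \<le> (\<Sum>k\<in>UNIV. Q $ i $ k * y $ i)"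
      using sto[OF Q] F(2)[OF True]
      by (intro sum_mono mult_left_mono) (auto simp: stochastic_def)
    also have "\<dots> = y $ i"
      using sto[OF Q] by (simp add: stochastic_def flip: sum_distrib_right)
    finally have "(\<Sum>k\<in>UNIV. Q $ i $ k * y $ k) \<le> x $ i - w $ i" by (simp add: y_def)
    moreover have "(\<Sum>k\<in>UNIV. Q $ i $ k * (z $ k - x $ k)) \<le> g z $ i - x $ i"
      using Q[unfolded mem_subdifferential_iff, rule_format, of i z] by (simp add: x)
    ultimately show ?thesis
      using True by (simp add: R_def y_def w right_diff_distrib sum_subtractf)
  next
    case False
    then show ?thesis
      using P[unfolded mem_subdifferential_iff, rule_format, of i z] by (simp add: R_def)
  qed
  then have "R \<in> subdifferential g w" by (simp add: mem_subdifferential_iff)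
  moreover have "F \<in> final_classes (matrix_graph R)"
    by (rule final_class_cong[OF F(1)]) (simp add: R_def)
  ultimately have j: "j \<in> verts ?G"
    using \<open>j \<in> F\<close> by (auto simp: verts_critical_graph)
  \<comment> \<open>The minimum is attained at \<open>i\<close> and the maximum at \<open>j\<close>;
    both nodes are critical, so the two values agree.\<close>
  have "y $ k = y $ i" for k
    using F(2)[OF \<open>j \<in> F\<close>, of k] i(2)[of k] const[OF i(1) j] by simp
  then have "x = add_const (y $ i) w"
    unfolding vec_eq_iff add_const_nth by (metis add.commute diff_add_cancel vector_minus_component y_def)
  then show ?thesis ..
qed


section \<open>Existence of eigenvectors\<close>

lemma discounted_eigenvector:
  fixes f :: "real ^ 'n \<Rightarrow> real ^ 'n"
  assumes "mono f" "add_homogeneous f" and \<alpha>: "0 < \<alpha>" "\<alpha> < 1"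
  shows "\<exists>u d. f u = add_const d (u /\<^sub>R \<alpha>) \<and> (\<forall>i. 0 \<le> u $ i) \<and> (\<exists>i. u $ i = 0)"
proof -
  \<comment> \<open>\<open>N\<close> solves norm (f 0) + \<alpha> N = N, so the box of radius
    \<open>N\<close> is mapped into itself.\<close>
  define N where "N = norm (f 0) / (1 - \<alpha>)"
  have N: "norm (f 0) = (1 - \<alpha>) * N" "0 \<le> N" using \<alpha> by (simp_all add: N_def)
  define B where "B = cbox (add_const (- N) 0) (add_const N 0 :: real ^ 'n)"
  have B: "x \<in> B \<longleftrightarrow> (\<forall>i. \<bar>x $ i\<bar> \<le> N)" for x
    by (auto simp: B_def mem_box_cart abs_le_iff minus_le_iff)
  have "(\<lambda>x. f (\<alpha> *\<^sub>R x)) \<in> B \<rightarrow> B"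
  proof (rule funcsetI)
    fix x assume x: "x \<in> B"
    have "\<bar>f (\<alpha> *\<^sub>R x) $ i\<bar> \<le> N" for i
    proof -
      have "\<alpha> *\<^sub>R x \<le> add_const (\<alpha> * N) 0" "add_const (- (\<alpha> * N)) 0 \<le> \<alpha> *\<^sub>R x"
        using x \<alpha> mult_left_mono[of "x $ j" N \<alpha> for j] mult_left_mono[of "- N" "x $ j" \<alpha> for j]
        by (simp_all add: less_eq_vec_iff B abs_le_iff minus_le_iff)
      then have "f (\<alpha> *\<^sub>R x) \<le> add_const (\<alpha> * N) (f 0)"
        "add_const (- (\<alpha> * N)) (f 0) \<le> f (\<alpha> *\<^sub>R x)"
        using monoD[OF assms(1)] add_homogeneousD[OF assms(2)] by metis+
      then have "f (\<alpha> *\<^sub>R x) $ i \<le> \<alpha> * N + f 0 $ i" "- (\<alpha> * N) + f 0 $ i \<le> f (\<alpha> *\<^sub>R x) $ i"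
        by (auto simp: less_eq_vec_iff)
      moreover have "\<bar>f 0 $ i\<bar> \<le> N - \<alpha> * N"
        using component_le_norm_cart[of "f 0" i] N(1) by (simp add: algebra_simps)
      ultimately show ?thesis by linarith
    qed
    then show "f (\<alpha> *\<^sub>R x) \<in> B" by (simp add: B)
  qed
  moreover have "continuous_on B (\<lambda>x. f (\<alpha> *\<^sub>R x))"
    unfolding continuous_on_def
    by (intro ballI tendsto_nonexpansive[OF assms(1,2)] tendsto_intros)
  moreover have "B \<noteq> {}" using B[of 0] N(2) by auto
  ultimately obtain x where x: "f (\<alpha> *\<^sub>R x) = x"
    using brouwer[of B "\<lambda>x. f (\<alpha> *\<^sub>R x)"] unfolding B_def
    by (metis compact_cbox convex_box(1))
  define m where "m = Min (range (($) x))"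
  have m: "m \<le> x $ i" for i by (simp add: m_def)
  have "m \<in> range (($) x)" unfolding m_def by (rule Min_in) simp_all
  then obtain k where k: "x $ k = m" by auto
  \<comment> \<open>Subtracting \<alpha> m makes the minimum of \<alpha> x zero; then u / \<alpha>
    is x - m while f u is x - \<alpha> m.\<close>
  define u where "u = add_const (- (\<alpha> * m)) (\<alpha> *\<^sub>R x)"
  have "f u = add_const (m - \<alpha> * m) (u /\<^sub>R \<alpha>)"
    using \<alpha> by (simp add: u_def add_homogeneousD[OF assms(2)] x vec_eq_iff field_simps)
  moreover have "\<forall>i. 0 \<le> u $ i" using m \<alpha> by (simp add: u_def)
  moreover have "u $ k = 0" using k by (simp add: u_def)
  ultimately show ?thesis by blast
qed

text \<open>Convergence of \<open>d\<close> is not assumed: it follows in any one coordinate, and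
  its limit is the same whichever coordinate is used.\<close>

lemma tendsto_add_const_limit:
  fixes b :: "nat \<Rightarrow> real ^ 'n"
  assumes "(\<lambda>n. add_const (d n) (b n)) \<longlonglongrightarrow> y" "b \<longlonglongrightarrow> l"
  shows "\<exists>c. y = add_const c l"
proof -
  have d: "d \<longlonglongrightarrow> y $ i - l $ i" for i
    using tendsto_diff[OF tendsto_vec_nth[OF assms(1)] tendsto_vec_nth[OF assms(2)], of i i]
    by simp
  then have "y $ i - l $ i = y $ j - l $ j" for i j
    using LIMSEQ_unique by blast
  then have "y $ i = (y $ j - l $ j) + l $ i" for i j
    by (metis diff_add_cancel)
  then show ?thesis by (auto simp: vec_eq_iff)
qed

lemma eigenvector_if_recession_eigenvectors_constant:
  fixes f fhat :: "real ^ 'n \<Rightarrow> real ^ 'n"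
  assumes "mono f" "add_homogeneous f" "has_recession_function f fhat"
    and trivial: "\<And>x c. fhat x = add_const c x \<Longrightarrow> \<exists>m. x = add_const m 0"
  shows "\<exists>v c. f v = add_const c v"
proof -
  \<comment> \<open>The offset 2 keeps \<open>\<alpha> 0\<close> positive.\<close>
  define \<alpha> where "\<alpha> n = 1 - inverse (real (n + 2))" for n
  have \<alpha>: "0 < \<alpha> n" "\<alpha> n < 1" for n by (simp_all add: \<alpha>_def field_simps)
  have \<alpha>_lim: "\<alpha> \<longlonglongrightarrow> 1"
    unfolding \<alpha>_def by real_asymp
  obtain u d where u: "f (u n) = add_const (d n) (u n /\<^sub>R \<alpha> n)" "\<forall>i. 0 \<le> u n $ i" "\<exists>i. u n $ i = 0" for n
    using discounted_eigenvector[OF assms(1,2) \<alpha>] by metis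
  have scaled_lim: "(\<lambda>n. z n /\<^sub>R \<alpha> (r n)) \<longlonglongrightarrow> l" if "z \<longlonglongrightarrow> l" "strict_mono r" for z :: "nat \<Rightarrow> real ^ 'n" and l and r :: "nat \<Rightarrow> nat"
    using tendsto_scaleR[OF tendsto_inverse[OF LIMSEQ_subseq_LIMSEQ[OF \<alpha>_lim that(2)] one_neq_zero] that(1)]
    by (simp add: o_def)
  show ?thesis
  \<comment> \<open>Either some subsequence of \<open>u\<close> is bounded, or the norms tend to
    infinity along the whole sequence.\<close>
  proof (cases "\<exists>B. infinite {n. norm (u n) \<le> B}")
    case True
    then obtain B and q :: "nat \<Rightarrow> nat" where q: "strict_mono q" "\<And>n. norm (u (q n)) \<le> B"
      using infinite_enumerate by blast
    have "bounded (range (u \<circ> q))" using q(2) by (auto simp: bounded_iff)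
    then obtain l and s :: "nat \<Rightarrow> nat" where s: "strict_mono s" "((u \<circ> q) \<circ> s) \<longlonglongrightarrow> l"
      using bounded_imp_convergent_subsequence by blast
    define r where "r = q \<circ> s"
    have r: "strict_mono r" "(\<lambda>n. u (r n)) \<longlonglongrightarrow> l"
      using strict_mono_o[OF q(1) s(1)] s(2) by (simp_all add: r_def o_def)
    have "(\<lambda>n. add_const (d (r n)) (u (r n) /\<^sub>R \<alpha> (r n))) \<longlonglongrightarrow> f l"
      using tendsto_nonexpansive[OF assms(1,2) r(2)] by (simp add: u(1))
    from tendsto_add_const_limit[OF this scaled_lim[OF r(2,1)]] show ?thesis by blast
  next
    case False
    define \<mu> where "\<mu> n = norm (u n)" for n
    have \<mu>_lim: "filterlim \<mu> at_top sequentially"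
      unfolding filterlim_at_top_dense
    proof
      fix B
      have "finite {n. \<mu> n \<le> B}" using False by (simp add: \<mu>_def)
      then have "eventually (\<lambda>n. \<not> \<mu> n \<le> B) sequentially"
        by (simp add: cofinite_eq_sequentially[symmetric] eventually_cofinite)
      then show "eventually (\<lambda>n. B < \<mu> n) sequentially" by (simp add: not_le)
    qed
    define z where "z n = u n /\<^sub>R \<mu> n" for n
    \<comment> \<open>If \<open>u n = 0\<close>, then \<open>z n = 0\<close> because
      \<open>inverse 0 = 0\<close>; the norm is 1 only for nonzero \<open>u n\<close>.\<close>
    have "norm (z n) \<le> 1" for n by (cases "u n = 0") (simp_all add: z_def \<mu>_def)
    then have "bounded (range z)" by (auto simp: bounded_iff)
    then obtain l and r :: "nat \<Rightarrow> nat" where r: "strict_mono r" "(z \<circ> r) \<longlonglongrightarrow> l"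
      using bounded_imp_convergent_subsequence by blast
    have z_lim: "(\<lambda>n. z (r n)) \<longlonglongrightarrow> l" using r(2) by (simp add: o_def)
    have \<mu>r_lim: "filterlim (\<lambda>n. \<mu> (r n)) at_top sequentially"
      using filterlim_compose[OF \<mu>_lim filterlim_subseq[OF r(1)]] .
    have pos: "eventually (\<lambda>n. 0 < \<mu> (r n)) sequentially"
      using \<mu>r_lim by (simp add: filterlim_at_top_dense)
    \<comment> \<open>The left side is f (\<mu> z) / \<mu>. By nonexpansiveness, replacing
      \<open>z\<close> by its limit \<open>l\<close> costs at most
      \<open>norm (z (r n) - l)\<close>, whatever \<mu> is, and f (\<mu> l) / \<mu> tends to
      \<open>fhat l\<close>.\<close>
    have "(\<lambda>n. add_const (d (r n) / \<mu> (r n)) (z (r n) /\<^sub>R \<alpha> (r n))) \<longlonglongrightarrow> fhat l"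
    proof (rule vec_tendstoI)
      fix i
      have "eventually (\<lambda>n. norm (add_const (d (r n) / \<mu> (r n)) (z (r n) /\<^sub>R \<alpha> (r n)) $ i
          - inverse (\<mu> (r n)) * f (\<mu> (r n) *\<^sub>R l) $ i) \<le> norm (z (r n) - l)) sequentially"
        using pos
      proof eventually_elim
        case (elim n)
        have "\<bar>f (u (r n)) $ i - f (\<mu> (r n) *\<^sub>R l) $ i\<bar> \<le> norm (u (r n) - \<mu> (r n) *\<^sub>R l)"
          by (rule nonexpansive_component[OF assms(1,2)])
        also have "u (r n) - \<mu> (r n) *\<^sub>R l = \<mu> (r n) *\<^sub>R (z (r n) - l)"
          using elim by (simp add: z_def scaleR_diff_right)
        also have "norm \<dots> = \<mu> (r n) * norm (z (r n) - l)"
          using elim by simp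
        finally have "inverse (\<mu> (r n)) * \<bar>f (u (r n)) $ i - f (\<mu> (r n) *\<^sub>R l) $ i\<bar>
            \<le> norm (z (r n) - l)"
          using elim by (simp add: field_simps)
        moreover have "add_const (d (r n) / \<mu> (r n)) (z (r n) /\<^sub>R \<alpha> (r n)) $ i
            - inverse (\<mu> (r n)) * f (\<mu> (r n) *\<^sub>R l) $ i
            = inverse (\<mu> (r n)) * (f (u (r n)) $ i - f (\<mu> (r n) *\<^sub>R l) $ i)"
          by (simp add: u(1) z_def divide_inverse algebra_simps)
        ultimately show ?case using elim by (simp add: abs_mult)
      qed
      then have "(\<lambda>n. add_const (d (r n) / \<mu> (r n)) (z (r n) /\<^sub>R \<alpha> (r n)) $ i
          - inverse (\<mu> (r n)) * f (\<mu> (r n) *\<^sub>R l) $ i) \<longlonglongrightarrow> 0"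
        by (rule Lim_null_comparison) (use z_lim in \<open>simp add: LIM_zero tendsto_norm_zero\<close>)
      from tendsto_add[OF this filterlim_compose[OF recession_component[OF assms(3), of l i] \<mu>r_lim]]
      show "(\<lambda>n. add_const (d (r n) / \<mu> (r n)) (z (r n) /\<^sub>R \<alpha> (r n)) $ i) \<longlonglongrightarrow> fhat l $ i"
        by simp
    qed
    from tendsto_add_const_limit[OF this scaled_lim[OF z_lim r(1)]]
    obtain m where m: "l = add_const m 0" using trivial by blast
    \<comment> \<open>Every \<open>z n\<close> has a zero coordinate, but its index varies with
      \<open>n\<close>. The product of the coordinates covers all indices at once; it vanishes in
      the limit, so the constant vector \<open>l\<close> is zero, against
      \<open>norm l = 1\<close>.\<close>
    have "(\<lambda>n. \<Prod>i\<in>UNIV. z (r n) $ i) \<longlonglongrightarrow> (\<Prod>i\<in>UNIV. l $ i)"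
      by (intro tendsto_prod tendsto_vec_nth z_lim)
    moreover have "(\<Prod>i\<in>UNIV. z n $ i) = 0" for n
      using u(3)[of n] by (auto simp: z_def prod_zero_iff)
    ultimately have "(\<Prod>i\<in>UNIV. l $ i) = 0"
      by (simp add: LIMSEQ_const_iff)
    then have "l = 0" using m by (simp add: vec_eq_iff)
    moreover have "norm l = 1"
    proof (rule LIMSEQ_unique)
      show "(\<lambda>n. norm (z (r n))) \<longlonglongrightarrow> norm l" by (intro tendsto_norm z_lim)
      show "(\<lambda>n. norm (z (r n))) \<longlonglongrightarrow> 1"
        by (rule tendsto_eventually) (use pos in eventually_elim, simp add: z_def \<mu>_def)
    qed
    ultimately show ?thesis by simp
  qed
qed

theorem corollary1p2:
  fixes f fhat :: "real ^ 'n \<Rightarrow> real ^ 'n" and w :: "real ^ 'n"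
  assumes "mono f" and "add_homogeneous f"
    and "has_recession_function f fhat"
    and "convex_map fhat"
    and "eigenvector fhat w"
    and "\<exists>!C. C \<in> critical_classes fhat w"
  shows "\<exists>v c. f v = add_const c v"
proof (rule eigenvector_if_recession_eigenvectors_constant[OF assms(1-3)])
  have fhat: "mono fhat" "add_homogeneous fhat" "fhat 0 = 0"
    using mono_recession[OF assms(1,3)] add_homogeneous_recession[OF assms(2,3)]
      recession_zero[OF assms(3)] by auto
  have fixed: "fhat x = x" if "fhat x = add_const c x" for x c
    using eigenvalue_zero[OF fhat that] that by (simp add: vec_eq_iff)
  have w: "fhat w = w" using assms(5) fixed by (auto simp: eigenvector_def)
  fix x c assume "fhat x = add_const c x"
  then have "fhat x = x" by (rule fixed)
  \<comment> \<open>Critical classes are given at \<open>w\<close>, so \<open>x\<close> and the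
    eigenvector \<open>0\<close> are each compared with \<open>w\<close> rather than with each
    other.\<close>
  then obtain a b where "x = add_const a w" "0 = add_const b w"
    using eigenvectors_differ_by_constant[OF fhat(1,2) assms(4) w _ assms(6)] fhat(3) by blast
  then have "x = add_const (a - b) 0"
    by (simp add: vec_eq_iff eq_neg_iff_add_eq_0 add.commute)
  then show "\<exists>m. x = add_const m 0" ..
qed

end
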